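(* Let $\alpha>3$, $\beta>0$, $t_0>0$, let $\Phi:\mathcal H\to\mathbb R$ be a twice continuously differentiable convex function with $\operatorname{argmin}\Phi\neq\emptyset$, and let $x:[t_0,+\infty[\to\mathcal H$ be a solution of $$\ddot x(t)+\frac{\alpha}{t}\dot x(t)+\beta\nabla^2\Phi(x(t))\dot x(t)+\nabla\Phi(x(t))=0 .$$ Then, as $t\to+\infty$, $$\Phi(x(t))-\min\Phi=o\left(t^{-2}\right)\qquad\text{and}\qquad\|\dot x(t)+\beta\nabla\Phi(x(t))\|=o\left(t^{-1}\right).$$
   Context: $\mathcal H$ is a real Hilbert space with norm $\|\cdot\|$. A solution $x$ of the differential equation is a twice continuously differentiable function satisfying it for all $t\ge t_0$. *)

theory Defs
  imports "HOL-Analysis.Analysis" "HOL-Library.Landau_Symbols"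
begin

text \<open>Second-order Frechet differentiability on the whole space, with the second derivative
  continuous for the operator norm.\<close>

definition twice_cont_differentiable :: "('a::real_normed_vector \<Rightarrow> real) \<Rightarrow> bool" where
  "twice_cont_differentiable f \<longleftrightarrow>
     (\<exists>(D :: 'a \<Rightarrow> 'a \<Rightarrow>\<^sub>L real) (D2 :: 'a \<Rightarrow> 'a \<Rightarrow>\<^sub>L 'a \<Rightarrow>\<^sub>L real).
        (\<forall>y. (f has_derivative blinfun_apply (D y)) (at y)) \<and>
        (\<forall>y. (D has_derivative blinfun_apply (D2 y)) (at y)) \<and>
        continuous_on UNIV D2)"

definition gradient :: "('a::real_inner \<Rightarrow> real) \<Rightarrow> 'a \<Rightarrow> 'a" where
  "gradient f y = (THE g. GDERIV f y :> g)"

text \<open>The Hessian as an operator on the space: the derivative of the gradient map.\<close>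

definition hessian :: "('a::real_inner \<Rightarrow> real) \<Rightarrow> 'a \<Rightarrow> 'a \<Rightarrow> 'a" where
  "hessian f y = frechet_derivative (gradient f) (at y)"

text \<open>\<open>x'\<close> and \<open>x''\<close> are the first and second derivatives of \<open>x\<close> on \<open>[t0, \<infinity>)\<close>
  (one-sided at \<open>t0\<close>); the values of \<open>x\<close> to the left of \<open>t0\<close> play no role.\<close>

definition is_solution ::
  "real \<Rightarrow> real \<Rightarrow> real \<Rightarrow> ('a::real_inner \<Rightarrow> real) \<Rightarrow>
   (real \<Rightarrow> 'a) \<Rightarrow> (real \<Rightarrow> 'a) \<Rightarrow> (real \<Rightarrow> 'a) \<Rightarrow> bool" where
  "is_solution \<alpha> \<beta> t0 \<Phi> x x' x'' \<longleftrightarrow>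
     (\<forall>t\<ge>t0. (x has_vector_derivative x' t) (at t within {t0..})) \<and>
     (\<forall>t\<ge>t0. (x' has_vector_derivative x'' t) (at t within {t0..})) \<and>
     continuous_on {t0..} x'' \<and>
     (\<forall>t\<ge>t0. x'' t + (\<alpha> / t) *\<^sub>R x' t + \<beta> *\<^sub>R hessian \<Phi> (x t) (x' t) + gradient \<Phi> (x t) = 0)"

end

theory Submission
  imports Defs
begin

text \<open>Fix a minimiser \<open>z\<close> and put \<open>u = x - z\<close>, \<open>v = x' + \<beta> \<nabla>\<Phi>(x)\<close>, \<open>\<phi> = \<Phi>(x) - min \<Phi>\<close>. The equation
  reads \<open>v' = - (\<alpha> / t) x' - \<nabla>\<Phi>(x)\<close>, free of the Hessian. For \<open>2 < \<lambda> < \<alpha> - 1\<close> the energy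
  \<open>t (t + \<beta> (\<alpha> - \<lambda> - 2)) \<phi> + (norm (\<lambda> u + t v))\<^sup>2 / 2 + \<lambda> (\<alpha> - 1 - \<lambda>) (norm u)\<^sup>2 / 2\<close>
  is eventually nonnegative and nonincreasing, hence convergent. It has the form \<open>A + \<lambda> B\<close> with
  \<open>A\<close>, \<open>B\<close> independent of \<open>\<lambda>\<close>, so comparing two values of \<open>\<lambda>\<close> shows that \<open>A\<close> itself converges.
  The energy moreover decreases at rate at least a constant times \<open>A / t\<close>; as \<open>1 / t\<close> is not
  integrable at infinity, the limit of \<open>A\<close> is zero. Finally \<open>A\<close> dominates \<open>t\<^sup>2 \<phi>\<close> and
  \<open>t\<^sup>2 (norm v)\<^sup>2 / 2\<close>.\<close>

section \<open>Riesz representation\<close>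

lemma riesz_representation:
  fixes f :: "'a::{real_inner, complete_space} \<Rightarrow>\<^sub>L real"
  shows "\<exists>r. \<forall>y. blinfun_apply f y = inner r y"
proof -
  \<comment> \<open>The representing vector is the minimiser of \<open>J\<close>; minimising sequences are Cauchy by the
    parallelogram law.\<close>
  define J where "J = (\<lambda>z. (norm z)\<^sup>2 / 2 - blinfun_apply f z)"
  define m where "m = Inf (range J)"
  have "J z \<ge> - (norm f)\<^sup>2 / 2" for z
  proof -
    have "blinfun_apply f z \<le> norm f * norm z"
      using norm_blinfun[of f z] by simp
    moreover have "0 \<le> (norm z - norm f)\<^sup>2" by simp
    ultimately show ?thesis
      by (simp add: J_def power2_eq_square algebra_simps)
  qed
  hence bdd: "bdd_below (range J)" by (auto intro!: bdd_belowI)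
  have m_le: "m \<le> J z" for z
    unfolding m_def by (rule cInf_lower[OF _ bdd]) simp
  have "\<exists>z. J z < m + 1 / real (Suc n)" for n
    using cInf_lessD[of "range J" "m + 1 / real (Suc n)"] by (auto simp: m_def)
  then obtain s where s: "\<And>n. J (s n) < m + 1 / real (Suc n)" by metis
  have near: "(dist a b)\<^sup>2 \<le> 4 * (J a + J b - 2 * m)" for a b
  proof -
    have "J ((1/2) *\<^sub>R (a + b)) = (norm (a + b))\<^sup>2 / 8 - (f a + f b) / 2"
      by (simp add: J_def blinfun.scaleR_right blinfun.add_right power_mult_distrib power2_eq_square)
    moreover have "(norm (a + b))\<^sup>2 + (dist a b)\<^sup>2 = 2 * (norm a)\<^sup>2 + 2 * (norm b)\<^sup>2"
      by (simp add: dist_norm power2_norm_eq_inner algebra_simps inner_commute)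
    ultimately show ?thesis
      using m_le[of "(1/2) *\<^sub>R (a + b)"] by (simp add: J_def field_simps)
  qed
  have "Cauchy s"
  proof (rule metric_CauchyI)
    fix e :: real assume "e > 0"
    \<comment> \<open>The factor 8 fits \<open>near\<close>: two excesses below
      \<open>e\<^sup>2 / 8\<close> give a squared distance below
      \<open>4 * (e\<^sup>2 / 4)\<close>.\<close>
    then obtain N where N: "1 / real (Suc N) < e\<^sup>2 / 8"
      using reals_Archimedean[of "e\<^sup>2 / 8"] by (auto simp: inverse_eq_divide)
    have "dist (s i) (s j) < e" if "i \<ge> N" "j \<ge> N" for i j
    proof -
      have "J (s k) < m + e\<^sup>2 / 8" if "k \<ge> N" for k
      proof -
        have "1 / real (Suc k) \<le> 1 / real (Suc N)" using that by (simp add: frac_le)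
        thus ?thesis using s[of k] N by linarith
      qed
      from this[OF that(1)] this[OF that(2)]
      have "(dist (s i) (s j))\<^sup>2 < e\<^sup>2"
        using near[of "s i" "s j"] by argo
      thus ?thesis using \<open>e > 0\<close> by (simp add: power2_less_imp_less)
    qed
    thus "\<exists>M. \<forall>i\<ge>M. \<forall>j\<ge>M. dist (s i) (s j) < e" by blast
  qed
  then obtain r where r: "s \<longlonglongrightarrow> r" using Cauchy_convergent convergent_def by blast
  have "(\<lambda>n. J (s n)) \<longlonglongrightarrow> J r"
    unfolding J_def by (intro tendsto_intros r) simp_all
  moreover have "(\<lambda>n. m + 1 / real (Suc n)) \<longlonglongrightarrow> m + 0"
    by (intro tendsto_intros LIMSEQ_Suc[OF lim_1_over_n])
  ultimately have "J r \<le> m"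
    using LIMSEQ_le[of "\<lambda>n. J (s n)" "J r" "\<lambda>n. m + 1 / real (Suc n)" m] s
    by (auto intro: less_imp_le)
  hence rmin: "J r \<le> J z" for z using m_le[of z] by linarith
  have "blinfun_apply f y = inner r y" for y
  proof -
    \<comment> \<open>First-order condition: on the line through \<open>r\<close> in direction
      \<open>y\<close>, \<open>J\<close> is a quadratic in \<open>h\<close>. Its linear coefficient
      must vanish because \<open>h = 0\<close> is a minimum.\<close>
    have J_line: "J (r + h *\<^sub>R y) = J r + h * (inner r y - f y) + h\<^sup>2 * inner y y / 2" for h
      unfolding J_def power2_norm_eq_inner
      by (simp add: inner_add_left inner_add_right blinfun.add_right blinfun.scaleR_right
          inner_commute power2_eq_square field_simps)
    have "DERIV (\<lambda>h. J (r + h *\<^sub>R y)) 0 :> inner r y - f y"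
      unfolding J_line by (auto intro!: derivative_eq_intros)
    from DERIV_local_min[OF this zero_less_one] rmin show ?thesis by simp
  qed
  thus ?thesis by blast
qed

section \<open>Tangent inequality, gradient and Hessian\<close>

text \<open>Restricting \<open>f\<close> to the line through \<open>y\<close> and \<open>z\<close>
  reduces this to the tangent inequality for a convex function of one real variable, taken between 0
  and 1.\<close>

lemma convex_on_above_tangent_GDERIV:
  fixes f :: "'a::real_inner \<Rightarrow> real"
  assumes "convex_on UNIV f" and "GDERIV f y :> g"
  shows "f z \<ge> f y + inner g (z - y)"
proof -
  define h where "h = (\<lambda>s. f (y + s *\<^sub>R (z - y)))"
  have "convex_on UNIV h"
  proof (rule convex_onI)
    fix t a b :: real assume t: "0 < t" "t < 1"
    have "y + ((1 - t) *\<^sub>R a + t *\<^sub>R b) *\<^sub>R (z - y)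
        = (1 - t) *\<^sub>R (y + a *\<^sub>R (z - y)) + t *\<^sub>R (y + b *\<^sub>R (z - y))"
      by (simp add: algebra_simps)
    thus "h ((1 - t) *\<^sub>R a + t *\<^sub>R b) \<le> (1 - t) * h a + t * h b"
      unfolding h_def using convex_onD[OF assms(1), of t] t by simp
  qed simp
  moreover have "DERIV h 0 :> inner g (z - y)"
  proof -
    have "(f has_derivative (\<lambda>h. inner h g)) (at (y + 0 *\<^sub>R (z - y)))"
      using assms(2) by (simp add: gderiv_def)
    moreover have "((\<lambda>s. y + s *\<^sub>R (z - y)) has_derivative (\<lambda>s. s *\<^sub>R (z - y))) (at 0)"
      by (auto intro!: derivative_eq_intros)
    ultimately have "(h has_derivative (\<lambda>s. inner (s *\<^sub>R (z - y)) g)) (at 0)"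
      unfolding h_def by (rule has_derivative_compose[rotated])
    thus ?thesis
      by (simp add: has_field_derivative_def inner_commute mult.commute[of _ "inner _ _"])
  qed
  ultimately have "h 1 - h 0 \<ge> inner g (z - y) * (1 - 0)"
    by (intro convex_on_imp_above_tangent[where A=UNIV]) auto
  thus ?thesis by (simp add: h_def)
qed

text \<open>The Riesz map \<open>R\<close> from functionals to vectors is bounded and linear, so
  \<open>gradient \<Phi>\<close> is \<open>R\<close> composed with the derivative \<open>D\<close>
  and inherits its differentiability. This justifies the descriptions behind \<open>gradient\<close>
  and \<open>hessian\<close>.\<close>

lemma twice_cont_differentiable_gradient:
  fixes \<Phi> :: "'a::{real_inner, complete_space} \<Rightarrow> real"
  assumes "twice_cont_differentiable \<Phi>"
  shows "GDERIV \<Phi> y :> gradient \<Phi> y"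
    and "(gradient \<Phi> has_derivative hessian \<Phi> y) (at y)"
proof -
  from assms obtain D D2 where D: "\<And>y. (\<Phi> has_derivative blinfun_apply (D y)) (at y)"
    and D2: "\<And>y. (D has_derivative blinfun_apply (D2 y)) (at y)"
    unfolding twice_cont_differentiable_def by blast
  obtain R :: "('a \<Rightarrow>\<^sub>L real) \<Rightarrow> 'a" where R: "\<And>f y. blinfun_apply f y = inner (R f) y"
    using riesz_representation by metis
  have uniq: "a = b" if "\<And>y. inner a y = inner b y" for a b :: 'a
    using that[of "a - b"] by (metis inner_diff_left inner_eq_zero_iff right_minus_eq)
  have "bounded_linear R"
  proof (rule bounded_linear_intro[where K=1])
    show "R (f + g) = R f + R g" for f g
      by (rule uniq) (simp add: R[symmetric] inner_add_left blinfun.add_left)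
    show "R (c *\<^sub>R f) = c *\<^sub>R R f" for c f
      by (rule uniq) (simp add: R[symmetric] blinfun.scaleR_left)
    show "norm (R f) \<le> norm f * 1" for f
    proof (cases "R f = 0")
      case False
      have "norm (R f) * norm (R f) = f (R f)" by (simp add: R norm_eq_sqrt_inner)
      also have "\<dots> \<le> norm f * norm (R f)" using norm_blinfun[of f "R f"] by simp
      finally show ?thesis using False by simp
    qed simp
  qed
  have G: "GDERIV \<Phi> y :> R (D y)" for y
  proof -
    have "blinfun_apply (D y) = (\<lambda>h. inner h (R (D y)))"
      by (simp add: fun_eq_iff R inner_commute)
    thus ?thesis using D[of y] by (simp add: gderiv_def)
  qed
  have gr: "gradient \<Phi> y = R (D y)" for y
    unfolding gradient_def
  proof (rule the_equality[where P="\<lambda>g. GDERIV \<Phi> y :> g", OF G])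
    fix g assume "GDERIV \<Phi> y :> g"
    hence "(\<lambda>h. inner h g) = (\<lambda>h. inner h (R (D y)))"
      using G[of y] unfolding gderiv_def by (rule has_derivative_unique)
    thus "g = R (D y)" by (intro uniq) (metis inner_commute)
  qed
  thus "GDERIV \<Phi> y :> gradient \<Phi> y" using G by simp
  have "((\<lambda>y. R (D y)) has_derivative (\<lambda>h. R (D2 y h))) (at y)"
    using bounded_linear.has_derivative[OF \<open>bounded_linear R\<close> D2] .
  moreover have "gradient \<Phi> = (\<lambda>y. R (D y))" using gr by blast
  ultimately show "(gradient \<Phi> has_derivative hessian \<Phi> y) (at y)"
    unfolding hessian_def using frechet_derivative_works differentiable_def by metis
qed

section \<open>Limits at infinity\<close>

lemma antimono_bdd_below_convergent_at_top:
  fixes f :: "real \<Rightarrow> real"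
  assumes "\<And>s t. T \<le> s \<Longrightarrow> s \<le> t \<Longrightarrow> f t \<le> f s" and "\<And>t. T \<le> t \<Longrightarrow> c \<le> f t"
  shows "\<exists>l. (f \<longlongrightarrow> l) at_top"
proof
  have bdd: "bdd_below (f ` {T..})" using assms(2) by (auto intro!: bdd_belowI)
  show "(f \<longlongrightarrow> Inf (f ` {T..})) at_top"
  proof (rule decreasing_tendsto)
    show "eventually (\<lambda>t. Inf (f ` {T..}) \<le> f t) at_top"
      using eventually_ge_at_top[of T] by eventually_elim (simp add: cInf_lower[OF _ bdd])
    fix y assume "Inf (f ` {T..}) < y"
    then obtain s where s: "s \<ge> T" "f s < y"
      using cInf_lessD[of "f ` {T..}" y] by auto
    show "eventually (\<lambda>t. f t < y) at_top"
      using eventually_ge_at_top[of s] by eventually_elim (meson assms(1) s le_less_trans)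
  qed
qed

text \<open>If \<open>L\<close> were positive, then eventually \<open>E' t \<le> - k / t\<close>
  with \<open>k = d * L / 2\<close>. Hence \<open>E t + k * ln t\<close> would be nonincreasing,
  which the lower bound on \<open>E\<close> forbids.\<close>

lemma limit_zero_of_log_dissipation:
  fixes E A :: "real \<Rightarrow> real"
  assumes E: "\<And>t. t \<ge> T \<Longrightarrow> (E has_real_derivative E' t) (at t)"
    and diss: "\<And>t. t \<ge> T \<Longrightarrow> E' t \<le> - (d * A t / t)"
    and bdd: "\<And>t. t \<ge> T \<Longrightarrow> c \<le> E t" and "d > 0"
    and A: "\<And>t. t \<ge> T \<Longrightarrow> 0 \<le> A t" "(A \<longlongrightarrow> L) at_top"
  shows "L = 0"
proof (rule ccontr)
  assume "L \<noteq> 0"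
  have "eventually (\<lambda>t. 0 \<le> A t) at_top"
    using eventually_ge_at_top[of T] by eventually_elim (rule A)
  hence "L \<ge> 0" using A(2) by (simp add: tendsto_lowerbound)
  with \<open>L \<noteq> 0\<close> have "L > 0" by simp
  hence "eventually (\<lambda>t. L / 2 < A t) at_top" using A(2) by (intro order_tendstoD) auto
  then obtain T1 where T1: "\<And>t. t \<ge> T1 \<Longrightarrow> L / 2 < A t"
    by (auto simp: eventually_at_top_linorder)
  define S where "S = max 1 (max T T1)"
  define k where "k = d * L / 2"
  have "k > 0" using \<open>d > 0\<close> \<open>L > 0\<close> by (simp add: k_def)
  have dec: "E t + k * ln t \<le> E S + k * ln S" if "t \<ge> S" for t
  proof (rule DERIV_nonpos_imp_nonincreasing[OF that])
    fix s assume s: "S \<le> s" "s \<le> t"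
    hence s': "s \<ge> T" "s \<ge> T1" "s > 0" by (auto simp: S_def)
    have "((\<lambda>t. E t + k * ln t) has_real_derivative E' s + k / s) (at s)"
      using s' by (auto intro!: derivative_eq_intros E)
    moreover have "k / s \<le> d * A s / s"
    proof (rule divide_right_mono)
      have "d * (L / 2) \<le> d * A s"
        using T1[OF s'(2)] \<open>d > 0\<close> by (intro mult_left_mono) auto
      thus "k \<le> d * A s" by (simp add: k_def)
    qed (use s' in simp)
    ultimately show "\<exists>y. ((\<lambda>t. E t + k * ln t) has_real_derivative y) (at s) \<and> y \<le> 0"
      using diss[OF s'(1)] by (intro exI[of _ "E' s + k / s"]) auto
  qed
  have "filterlim (\<lambda>t. k * ln t) at_top at_top"
    using \<open>k > 0\<close> by (intro filterlim_tendsto_pos_mult_at_top[OF tendsto_const _ ln_at_top])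
  hence "eventually (\<lambda>t. k * ln t > E S + k * ln S - c) at_top"
    by (simp add: filterlim_at_top_dense)
  hence "eventually (\<lambda>t::real. False) at_top"
    using eventually_ge_at_top[of S]
  proof eventually_elim
    case (elim t)
    thus ?case using dec[of t] bdd[of t] by (simp add: S_def)
  qed
  thus False by simp
qed

section \<open>The energy of an abstract trajectory\<close>

lemma has_real_derivative_inner:
  assumes "(f has_vector_derivative f') (at t within S)" "(g has_vector_derivative g') (at t within S)"
  shows "((\<lambda>t. inner (f t) (g t)) has_real_derivative inner (f t) g' + inner f' (g t)) (at t within S)"
  using has_derivative_inner[OF assms[unfolded has_vector_derivative_def]]
  by (rule has_derivative_imp_has_field_derivative) (simp add: algebra_simps)

text \<open>The convexity of \<open>\<Phi>\<close> enters only through the assumption \<open>\<phi>_le\<close>.\<close>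

locale dissipative_trajectory =
  fixes \<alpha> \<beta> t0 :: real and u u' v g :: "real \<Rightarrow> 'a::real_inner" and \<phi> :: "real \<Rightarrow> real"
  assumes \<alpha>: "\<alpha> > 3" and \<beta>: "\<beta> > 0" and t0: "t0 > 0"
    and u: "\<And>t. t > t0 \<Longrightarrow> (u has_vector_derivative u' t) (at t)"
    and v: "\<And>t. t > t0 \<Longrightarrow> (v has_vector_derivative - (\<alpha> / t) *\<^sub>R u' t - g t) (at t)"
    and \<phi>: "\<And>t. t > t0 \<Longrightarrow> (\<phi> has_real_derivative inner (g t) (u' t)) (at t)"
    and v_eq: "\<And>t. v t = u' t + \<beta> *\<^sub>R g t"
    and \<phi>_nonneg: "\<And>t. \<phi> t \<ge> 0"
    and \<phi>_le: "\<And>t. \<phi> t \<le> inner (g t) (u t)"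
begin

text \<open>The last summand is a correction of lower order in \<open>t\<close>; its derivative
  cancels the mixed terms \<open>inner (g t) (u' t)\<close>.\<close>

definition A where
  "A t = t\<^sup>2 * \<phi> t + t\<^sup>2 * inner (v t) (v t) / 2 + t * \<beta> * (\<alpha> - 2) * \<phi> t"

text \<open>The last two summands are chosen so that the terms in \<open>inner (g t) (u' t)\<close>
  and \<open>inner (u t) (u' t)\<close> cancel in the derivative.\<close>

definition B where
  "B t = t * inner (u t) (v t) - t * \<beta> * \<phi> t + (\<alpha> - 1) / 2 * inner (u t) (u t)"

definition E' where
  "E' l t = (2 * t + \<beta> * (\<alpha> - l - 2)) * \<phi> t - l * (t - \<beta>) * inner (g t) (u t)
     - (\<alpha> - 1 - l) * t * inner (u' t) (u' t) - t * \<beta> * (t - \<beta>) * inner (g t) (g t)"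

text \<open>Completing the square in \<open>u\<close> and \<open>v\<close> exhibits the energy as a
  sum of terms whose signs can be read off.\<close>

lemma energy_expand:
  "A t + l * B t = t * (t + \<beta> * (\<alpha> - l - 2)) * \<phi> t + (norm (l *\<^sub>R u t + t *\<^sub>R v t))\<^sup>2 / 2
     + l * (\<alpha> - 1 - l) / 2 * inner (u t) (u t)"
  unfolding A_def B_def power2_norm_eq_inner
  by (simp add: inner_add_left inner_add_right inner_commute power2_eq_square field_simps)

lemma energy_deriv:
  assumes "t > t0"
  shows "((\<lambda>t. A t + l * B t) has_real_derivative E' l t) (at t)"
proof -
  have t: "t > 0" using assms t0 by simp
  define w where "w = - (\<alpha> / t) *\<^sub>R u' t - g t"
  \<comment> \<open>Multiplying by \<open>t\<close> clears the singular coefficient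
    \<open>\<alpha> / t\<close>; every occurrence of \<open>w\<close> in the derivative carries this
    factor.\<close>
  have tw: "t * inner a w = - \<alpha> * inner a (u' t) - t * inner a (g t)" for a
    using t by (simp add: w_def inner_diff_right algebra_simps)
  note dv = v[OF assms, folded w_def]
  have uu: "((\<lambda>t. inner (u t) (u t)) has_real_derivative 2 * inner (u t) (u' t)) (at t)"
    using has_real_derivative_inner[OF u[OF assms] u[OF assms]] by (simp add: inner_commute)
  have vv: "((\<lambda>t. inner (v t) (v t)) has_real_derivative 2 * inner (v t) w) (at t)"
    using has_real_derivative_inner[OF dv dv] by (simp add: inner_commute)
  note uv = has_real_derivative_inner[OF u[OF assms] dv]
  have "((\<lambda>t. A t + l * B t) has_real_derivative
      2 * t * \<phi> t + t\<^sup>2 * inner (g t) (u' t) + t * inner (v t) (v t) + t * (t * inner (v t) w)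
      + \<beta> * (\<alpha> - 2) * (\<phi> t + t * inner (g t) (u' t))
      + l * (inner (u t) (v t) + t * inner (u t) w + t * inner (u' t) (v t)
             - \<beta> * (\<phi> t + t * inner (g t) (u' t)) + (\<alpha> - 1) * inner (u t) (u' t))) (at t)"
    unfolding A_def B_def
    by (auto intro!: derivative_eq_intros uu vv uv \<phi>[OF assms] simp: power2_eq_square field_simps)
  thus ?thesis
    unfolding tw E'_def v_eq
    by (rule DERIV_cong)
       (simp add: inner_add_left inner_add_right inner_commute power2_eq_square algebra_simps)
qed

section \<open>Decay rate of the energy\<close>

text \<open>A common decay rate: the three entries serve the terms in \<open>\<phi>\<close>, in
  \<open>u'\<close> and in \<open>g\<close>, respectively.\<close>

definition \<delta> where "\<delta> l = min ((l - 2) / 2) (min (\<alpha> - 1 - l) 1)"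

text \<open>Beyond this time \<open>\<beta> \<le> t - \<beta>\<close>, and half of
  \<open>(l - 2) * t\<close> absorbs the constant \<open>\<beta> * (\<alpha> - 2)\<close>.\<close>

definition T where "T l = max (max 1 (t0 + 1)) (max (2 * \<beta>) (2 * \<beta> * (\<alpha> - 2) / (l - 2)))"

lemma \<delta>_pos: "2 < l \<Longrightarrow> l < \<alpha> - 1 \<Longrightarrow> \<delta> l > 0"
  by (simp add: \<delta>_def)

lemma T_le:
  assumes "2 < l" "t \<ge> T l"
  shows "t \<ge> 1" "t > t0" "t \<ge> 2 * \<beta>" "\<beta> * (\<alpha> - 2) \<le> (l - 2) / 2 * t"
proof -
  have "2 * \<beta> * (\<alpha> - 2) / (l - 2) \<le> t" using assms by (simp add: T_def)
  thus "\<beta> * (\<alpha> - 2) \<le> (l - 2) / 2 * t" using assms(1) by (simp add: field_simps)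
qed (use assms in \<open>auto simp: T_def\<close>)

text \<open>Both sides are compared with \<open>t * (\<phi> t + V / 2)\<close>: the dissipation is
  at least \<open>\<delta> l\<close> times it, and \<open>A t / t\<close> is at most
  \<open>1 + \<beta> * (\<alpha> - 2)\<close> times it.\<close>

lemma E'_le:
  assumes l: "2 < l" "l < \<alpha> - 1" and "t \<ge> T l"
  shows "E' l t \<le> - (\<delta> l / (1 + \<beta> * (\<alpha> - 2)) * A t / t)"
proof -
  note t = T_le[OF l(1) assms(3)]
  define K where "K = 1 + \<beta> * (\<alpha> - 2)"
  have K: "K > 0" using \<alpha> \<beta> by (simp add: K_def add_pos_pos)
  define X where "X = inner (u' t) (u' t)"
  define G where "G = inner (g t) (g t)"
  define V where "V = inner (v t) (v t)"
  have nn: "X \<ge> 0" "G \<ge> 0" "V \<ge> 0" by (simp_all add: X_def G_def V_def)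
  note d = \<delta>_pos[OF l]
  \<comment> \<open>The parallelogram law for \<open>u'\<close> and
    \<open>\<beta> *\<^sub>R g\<close>, with the squared norm of the difference dropped.\<close>
  have V: "V / 2 \<le> X + \<beta>\<^sup>2 * G"
  proof -
    have "0 \<le> inner (u' t - \<beta> *\<^sub>R g t) (u' t - \<beta> *\<^sub>R g t)" by simp
    thus ?thesis
      by (simp add: V_def X_def G_def v_eq inner_add_left inner_add_right inner_diff_left
          inner_diff_right inner_commute power2_eq_square)
  qed
  have 1: "l * (t - \<beta>) * \<phi> t \<le> l * (t - \<beta>) * inner (g t) (u t)"
    using \<phi>_le l t \<beta> by (intro mult_left_mono) auto
  have 2: "\<delta> l * t * (\<beta>\<^sup>2 * G) \<le> t * \<beta> * (t - \<beta>) * G"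
  proof -
    have "\<delta> l * t * (\<beta>\<^sup>2 * G) \<le> 1 * t * (\<beta>\<^sup>2 * G)"
      using t nn by (intro mult_right_mono) (auto simp: \<delta>_def)
    also have "\<dots> = t * \<beta> * \<beta> * G" by (simp add: power2_eq_square)
    also have "\<dots> \<le> t * \<beta> * (t - \<beta>) * G"
      using t nn \<beta> by (intro mult_right_mono mult_left_mono) auto
    finally show ?thesis .
  qed
  have 3: "\<delta> l * t * X \<le> (\<alpha> - 1 - l) * t * X"
    using t nn by (intro mult_right_mono) (auto simp: \<delta>_def)
  \<comment> \<open>This is the coefficient of \<open>\<phi> t\<close> left after \<open>1\<close>
    replaces \<open>inner (g t) (u t)\<close> by \<open>\<phi> t\<close>. It is negative for large
    \<open>t\<close> since \<open>l > 2\<close>.\<close>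
  have 4: "((2 - l) * t + \<beta> * (\<alpha> - 2)) * \<phi> t \<le> - (\<delta> l * t * \<phi> t)"
  proof -
    have "\<delta> l * t \<le> (l - 2) / 2 * t"
      using t(1) unfolding \<delta>_def by (intro mult_right_mono min.cobounded1) simp
    hence "(2 - l) * t + \<beta> * (\<alpha> - 2) \<le> - (\<delta> l * t)" using t(4) by (simp add: field_simps)
    from mult_right_mono[OF this \<phi>_nonneg] show ?thesis by simp
  qed
  have 5: "\<delta> l * t * (V / 2) \<le> \<delta> l * t * (X + \<beta>\<^sup>2 * G)"
    using V d t by (intro mult_left_mono) auto
  have "E' l t \<le> - (\<delta> l * t * (\<phi> t + V / 2))"
    using 1 2 3 4 5 unfolding E'_def X_def[symmetric] G_def[symmetric]
    by (simp add: algebra_simps)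
  \<comment> \<open>The lower-order term of \<open>A t / t\<close> is absorbed using
    \<open>t \<ge> 1\<close>, which accounts for the constant \<open>K\<close>.\<close>
  moreover have "\<delta> l / K * A t / t \<le> \<delta> l * t * (\<phi> t + V / 2)"
  proof -
    have "0 \<le> \<beta> * (\<alpha> - 2) * t * V / 2" using \<alpha> \<beta> t nn by simp
    moreover have "\<beta> * (\<alpha> - 2) * \<phi> t * 1 \<le> \<beta> * (\<alpha> - 2) * \<phi> t * t"
      using \<alpha> \<beta> t \<phi>_nonneg by (intro mult_left_mono) auto
    moreover have "A t / t = t * \<phi> t + t * V / 2 + \<beta> * (\<alpha> - 2) * \<phi> t"
      using t by (simp add: A_def V_def power2_eq_square field_simps)
    ultimately have "A t / t \<le> K * (t * (\<phi> t + V / 2))"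
      by (simp add: K_def algebra_simps add_divide_distrib)
    hence "\<delta> l / K * (A t / t) \<le> \<delta> l / K * (K * (t * (\<phi> t + V / 2)))"
      using d K by (intro mult_left_mono) auto
    thus ?thesis using K by simp
  qed
  ultimately show ?thesis by (simp add: K_def)
qed

lemma A_ge:
  assumes "t > 0"
  shows "t\<^sup>2 * \<phi> t \<le> A t" "t\<^sup>2 * (norm (v t))\<^sup>2 / 2 \<le> A t" "0 \<le> A t"
  using assms \<alpha> \<beta> \<phi>_nonneg[of t] by (auto simp: A_def power2_norm_eq_inner)

lemma energy_nonneg:
  assumes l: "2 < l" "l < \<alpha> - 1" and "t \<ge> T l"
  shows "0 \<le> A t + l * B t"
proof -
  note t = T_le[OF l(1) assms(3)]
  \<comment> \<open>As \<open>l < \<alpha> - 1\<close>, the shift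
    \<open>\<beta> * (\<alpha> - l - 2)\<close> is at least \<open>- \<beta>\<close>, and
    \<open>t \<ge> 2 * \<beta>\<close> outweighs it.\<close>
  have "\<beta> * (- 1) \<le> \<beta> * (\<alpha> - l - 2)" using l \<beta> by (intro mult_left_mono) auto
  hence "0 \<le> t + \<beta> * (\<alpha> - l - 2)" using t \<beta> by simp
  thus ?thesis unfolding energy_expand using t l \<phi>_nonneg[of t] by simp
qed

lemma energy_convergent:
  assumes l: "2 < l" "l < \<alpha> - 1"
  shows "\<exists>L. ((\<lambda>t. A t + l * B t) \<longlongrightarrow> L) at_top"
proof (rule antimono_bdd_below_convergent_at_top[where T="T l" and c=0])
  fix s t assume st: "T l \<le> s" "s \<le> t"
  show "A t + l * B t \<le> A s + l * B s"
  proof (rule DERIV_nonpos_imp_nonincreasing[OF st(2)])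
    fix r assume "s \<le> r"
    hence r: "r \<ge> T l" using st by simp
    have "0 \<le> \<delta> l / (1 + \<beta> * (\<alpha> - 2)) * A r / r"
      using T_le[OF l(1) r] A_ge(3)[of r] \<delta>_pos[OF l] \<alpha> \<beta> by simp
    thus "\<exists>y. ((\<lambda>t. A t + l * B t) has_real_derivative y) (at r) \<and> y \<le> 0"
      using energy_deriv[OF T_le(2)[OF l(1) r]] E'_le[OF l r] by (intro exI[of _ "E' l r"]) auto
  qed
qed (rule energy_nonneg[OF l])

section \<open>Passage to the limit\<close>

lemma A_tendsto_0: "(A \<longlongrightarrow> 0) at_top"
proof -
  \<comment> \<open>The two points trisect the interval from 2 to \<open>\<alpha> - 1\<close>, which
    is nondegenerate because \<open>\<alpha> > 3\<close>.\<close>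
  define l m where "l = 2 + (\<alpha> - 3) / 3" and "m = 2 + 2 * (\<alpha> - 3) / 3"
  have l: "2 < l" "l < \<alpha> - 1" and m: "2 < m" "m < \<alpha> - 1" and "m - l \<noteq> 0"
    using \<alpha> by (auto simp: l_def m_def field_simps)
  obtain P Q where P: "((\<lambda>t. A t + l * B t) \<longlongrightarrow> P) at_top" and Q: "((\<lambda>t. A t + m * B t) \<longlongrightarrow> Q) at_top"
    using energy_convergent[OF l] energy_convergent[OF m] by blast
  \<comment> \<open>This combination of the two energies eliminates \<open>B\<close>.\<close>
  have "((\<lambda>t. (m * (A t + l * B t) - l * (A t + m * B t)) / (m - l)) \<longlongrightarrow> (m * P - l * Q) / (m - l)) at_top"
    by (intro tendsto_intros P Q \<open>m - l \<noteq> 0\<close>)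
  moreover have "(m * (A t + l * B t) - l * (A t + m * B t)) / (m - l) = A t" for t
    using \<open>m - l \<noteq> 0\<close> by (simp add: field_simps)
  ultimately have A: "(A \<longlongrightarrow> (m * P - l * Q) / (m - l)) at_top" by simp
  moreover have "(m * P - l * Q) / (m - l) = 0"
  proof (rule limit_zero_of_log_dissipation[OF _ E'_le[OF l] energy_nonneg[OF l] _ _ A])
    show "((\<lambda>t. A t + l * B t) has_real_derivative E' l t) (at t)" if "T l \<le> t" for t
      using energy_deriv T_le(2)[OF l(1) that] by blast
    show "0 < \<delta> l / (1 + \<beta> * (\<alpha> - 2))" using \<delta>_pos[OF l] \<alpha> \<beta> by (simp add: add_pos_pos)
    show "0 \<le> A t" if "T l \<le> t" for t
      using A_ge(3) T_le(1)[OF l(1) that] by simp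
  qed
  ultimately show ?thesis by simp
qed

lemma potential_smallo: "\<phi> \<in> o[at_top](\<lambda>t. 1 / t ^ 2)"
proof (rule smalloI_tendsto)
  have "((\<lambda>t. t\<^sup>2 * \<phi> t) \<longlongrightarrow> 0) at_top"
    by (rule tendsto_sandwich[OF _ _ tendsto_const A_tendsto_0])
       (use \<phi>_nonneg A_ge(1) in \<open>auto intro!: eventually_mono[OF eventually_gt_at_top[of 0]]\<close>)
  thus "((\<lambda>t. \<phi> t / (1 / t ^ 2)) \<longlongrightarrow> 0) at_top" by (simp add: mult.commute)
qed (auto intro!: eventually_mono[OF eventually_gt_at_top[of 0]])

lemma velocity_smallo: "(\<lambda>t. norm (v t)) \<in> o[at_top](\<lambda>t. 1 / t)"
proof (rule smalloI_tendsto)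
  have "((\<lambda>t. t\<^sup>2 * (norm (v t))\<^sup>2 / 2) \<longlongrightarrow> 0) at_top"
    by (rule tendsto_sandwich[OF _ _ tendsto_const A_tendsto_0])
       (use A_ge(2) in \<open>auto intro!: eventually_mono[OF eventually_gt_at_top[of 0]]\<close>)
  from tendsto_mult[OF this tendsto_const[of 2]]
  have "((\<lambda>t. (t * norm (v t))\<^sup>2) \<longlongrightarrow> 0) at_top" by (simp add: power_mult_distrib)
  hence "((\<lambda>t. t * norm (v t)) \<longlongrightarrow> 0) at_top"
    using tendsto_real_sqrt[of _ 0] by (fastforce simp: tendsto_rabs_zero_iff)
  thus "((\<lambda>t. norm (v t) / (1 / t)) \<longlongrightarrow> 0) at_top" by (simp add: mult.commute)
qed (auto intro!: eventually_mono[OF eventually_gt_at_top[of 0]])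

end

section \<open>Solutions of the differential equation\<close>

theorem theorem1p15:
  fixes \<Phi> :: "'a::{real_inner, complete_space} \<Rightarrow> real"
    and x x' x'' :: "real \<Rightarrow> 'a"
    and \<alpha> \<beta> t0 :: real
  assumes "\<alpha> > 3" and "\<beta> > 0" and "t0 > 0"
    and "twice_cont_differentiable \<Phi>"
    and "convex_on UNIV \<Phi>"
    and "{z. is_arg_min \<Phi> (\<lambda>_. True) z} \<noteq> {}"
    and "is_solution \<alpha> \<beta> t0 \<Phi> x x' x''"
  shows "(\<lambda>t. \<Phi> (x t) - (INF y. \<Phi> y)) \<in> o[at_top](\<lambda>t. 1 / t ^ 2) \<and>
         (\<lambda>t. norm (x' t + \<beta> *\<^sub>R gradient \<Phi> (x t))) \<in> o[at_top](\<lambda>t. 1 / t)"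
proof -
  obtain z where z: "\<And>y. \<Phi> z \<le> \<Phi> y"
    using assms(6) by (auto simp: is_arg_min_linorder)
  have inf: "(INF y. \<Phi> y) = \<Phi> z"
    by (rule cInf_eq_minimum) (use z in auto)
  note G = twice_cont_differentiable_gradient[OF assms(4)]
  \<comment> \<open>To the right of \<open>t0\<close> the one-sided derivatives are two-sided; the
    asymptotics concern only such \<open>t\<close>.\<close>
  have at: "at t within {t0..} = at t" if "t > t0" for t
    using that by (intro at_within_interior) simp
  have x: "(x has_vector_derivative x' t) (at t)"
    and x': "(x' has_vector_derivative x'' t) (at t)"
    and ode: "x'' t + (\<alpha> / t) *\<^sub>R x' t + \<beta> *\<^sub>R hessian \<Phi> (x t) (x' t) + gradient \<Phi> (x t) = 0"
    if "t > t0" for t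
    using assms(7) that at[OF that] unfolding is_solution_def by (metis less_imp_le)+
  have gx: "((\<lambda>t. gradient \<Phi> (x t)) has_vector_derivative hessian \<Phi> (x t) (x' t)) (at t)" if "t > t0" for t
  proof -
    from has_derivative_compose[OF x[OF that, unfolded has_vector_derivative_def] G(2)]
    have "((\<lambda>t. gradient \<Phi> (x t)) has_derivative (\<lambda>h. hessian \<Phi> (x t) (h *\<^sub>R x' t))) (at t)" .
    thus ?thesis
      using has_derivative_bounded_linear[OF G(2)]
      by (simp add: has_vector_derivative_def linear_simps)
  qed
  interpret dissipative_trajectory \<alpha> \<beta> t0 "\<lambda>t. x t - z" x'
    "\<lambda>t. x' t + \<beta> *\<^sub>R gradient \<Phi> (x t)" "\<lambda>t. gradient \<Phi> (x t)" "\<lambda>t. \<Phi> (x t) - \<Phi> z"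
  proof
    fix t
    show "0 \<le> \<Phi> (x t) - \<Phi> z" using z by simp
    \<comment> \<open>The tangent inequality based at \<open>x t\<close>, evaluated at the minimiser
      \<open>z\<close>.\<close>
    show "\<Phi> (x t) - \<Phi> z \<le> inner (gradient \<Phi> (x t)) (x t - z)"
      using convex_on_above_tangent_GDERIV[OF assms(5) G(1), of "x t" z]
      by (simp add: inner_diff_right)
    assume t: "t > t0"
    show "((\<lambda>t. x t - z) has_vector_derivative x' t) (at t)"
      using x[OF t] by (auto intro!: derivative_eq_intros)
    \<comment> \<open>By the chain rule \<open>gx\<close>, the Hessian term of the equation is the
      derivative of \<open>\<beta> *\<^sub>R gradient \<Phi> (x t)\<close>, so it is absorbed into
      the derivative of \<open>v\<close>.\<close>
    have "((\<lambda>t. x' t + \<beta> *\<^sub>R gradient \<Phi> (x t)) has_vector_derivative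
        x'' t + \<beta> *\<^sub>R hessian \<Phi> (x t) (x' t)) (at t)"
      by (rule derivative_eq_intros x'[OF t] gx[OF t] bounded_linear.has_vector_derivative[OF bounded_linear_scaleR_right] refl)+
    moreover have "x'' t + \<beta> *\<^sub>R hessian \<Phi> (x t) (x' t) = - (\<alpha> / t) *\<^sub>R x' t - gradient \<Phi> (x t)"
    proof -
      have "x'' t + \<beta> *\<^sub>R hessian \<Phi> (x t) (x' t) - (- (\<alpha> / t) *\<^sub>R x' t - gradient \<Phi> (x t)) = 0"
        using ode[OF t] by (simp add: algebra_simps)
      thus ?thesis by simp
    qed
    ultimately show "((\<lambda>t. x' t + \<beta> *\<^sub>R gradient \<Phi> (x t)) has_vector_derivative
        - (\<alpha> / t) *\<^sub>R x' t - gradient \<Phi> (x t)) (at t)" by simp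
    from has_derivative_compose[OF x[OF t, unfolded has_vector_derivative_def] G(1)[unfolded gderiv_def]]
    show "((\<lambda>t. \<Phi> (x t) - \<Phi> z) has_real_derivative inner (gradient \<Phi> (x t)) (x' t)) (at t)"
      unfolding has_field_derivative_def
      by (auto intro!: derivative_eq_intros simp: inner_commute mult.commute)
  qed (use assms in auto)
  show ?thesis using potential_smallo velocity_smallo unfolding inf by blast
qed

end
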